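(* Let $G$ be a discrete, countable abelian group and let $\pi: G \to B(H)$, $g \mapsto \pi_g$, be a unitary representation of $G$ on a Hilbert space $H$. Suppose that $\pi$ admits a finite complete wandering frame collection $W$. Suppose that $Y \subset H$ is a wandering frame collection for $\pi$ (so that $\{\pi_g y : g \in G,\ y \in Y\}$ is a frame for its closed linear span, a subspace of $H$). Then there exists an integer $k$, independent of the cardinality of $W$ and of $Y$, such that: (1) there exists a finite wandering frame collection $X$ for $\pi$ that is complementary to $Y$ and has cardinality $k$; and (2) if $Z$ is any wandering frame collection complementary to $Y$, then the cardinality of $Z$ is at least $k$. Moreover, $X$ in (1) can be taken so that the frame $\{\pi_g x : g\in G,\ x\in X\}$ (for its closed linear span) is normalized tight, regardless of whether the frames generated by $W$ and $Y$ are normalized tight.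
   Context: A sequence $\{f_i\}_{i\in I}$ is a frame for a separable Hilbert space $K$ if there are constants $A,B>0$ with $A\|x\|^2 \le \sum_{i\in I}|\langle x,f_i\rangle|^2 \le B\|x\|^2$ for all $x\in K$; it is normalized tight if one can take $A=B=1$. A finite collection of vectors $W=\{w_1,\dots,w_n\}\subset H$ is a wandering frame collection for $\pi$ if the family $\{\pi_g w_i : g\in G,\ i=1,\dots,n\}$ is a frame for its closed linear span (this is the frame generated by $W$); it is a complete wandering frame collection if this family is a frame for $H$. Two wandering frame collections $X=\{x_1,\dots,x_n\}$ and $Y=\{y_1,\dots,y_m\}$ for $\pi$ on $H$ are complementary if $X\cup Y$ is a complete wandering frame collection for $\pi$ on $H$ (the subspaces they generate are not required to be orthogonal). *)

theory Defs
  imports "HOL-Analysis.Analysis" "HOL-Algebra.Group"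
begin

text \<open>
  Complex Hilbert spaces. The real structure (norm, metric, topology, completeness) is
  inherited from the library; \<^emph>\<open>cscale\<close> extends the real scaling, and the norm
  is the one induced by \<^emph>\<open>cinner\<close>, which is linear in its first argument.
  Positive definiteness of \<^emph>\<open>cinner\<close> is a consequence of \<^emph>\<open>cinner_self\<close>.
\<close>

class complex_hilbert = real_inner + complete_space +
  fixes cscale :: "complex \<Rightarrow> 'a \<Rightarrow> 'a"  (infixr "*c" 75)
    and cinner :: "'a \<Rightarrow> 'a \<Rightarrow> complex"
  assumes cscale_add_right: "a *c (x + y) = a *c x + a *c y"
    and cscale_add_left: "(a + b) *c x = a *c x + b *c x"
    and cscale_cscale: "a *c (b *c x) = (a * b) *c x"
    and cscale_of_real: "complex_of_real r *c x = r *\<^sub>R x"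
    and cinner_commute: "cinner x y = cnj (cinner y x)"
    and cinner_add_left: "cinner (x + y) z = cinner x z + cinner y z"
    and cinner_cscale_left: "cinner (a *c x) y = a * cinner x y"
    and cinner_self: "cinner x x = complex_of_real ((norm x)\<^sup>2)"

global_interpretation complex_vector:
  vector_space "cscale :: complex \<Rightarrow> 'a \<Rightarrow> 'a::complex_hilbert"
  defines cspan = complex_vector.span
proof
  fix x :: 'a
  show "1 *c x = x"
    using cscale_of_real[of 1 x] by simp
qed (simp_all add: cscale_add_right cscale_add_left cscale_cscale)

definition unitary_op :: "('h::complex_hilbert \<Rightarrow> 'h) \<Rightarrow> bool" where
  "unitary_op U \<longleftrightarrow>
     Vector_Spaces.linear cscale cscale U \<and> bij U \<and> (\<forall>x y. cinner (U x) (U y) = cinner x y)"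

definition unitary_representation ::
    "('g, 'b) monoid_scheme \<Rightarrow> ('g \<Rightarrow> 'h::complex_hilbert \<Rightarrow> 'h) \<Rightarrow> bool" where
  "unitary_representation G \<pi> \<longleftrightarrow>
     (\<forall>g\<in>carrier G. unitary_op (\<pi> g)) \<and>
     (\<forall>g\<in>carrier G. \<forall>h\<in>carrier G. \<pi> (g \<otimes>\<^bsub>G\<^esub> h) = \<pi> g \<circ> \<pi> h)"

text \<open>In the following, \<open>K\<close> is meant to be a closed complex subspace of the ambient space.\<close>

definition frame_with_bounds ::
    "real \<Rightarrow> real \<Rightarrow> 'i set \<Rightarrow> ('i \<Rightarrow> 'h::complex_hilbert) \<Rightarrow> 'h set \<Rightarrow> bool" where
  "frame_with_bounds A B I f K \<longleftrightarrow>
     f ` I \<subseteq> K \<and>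
     (\<forall>x\<in>K. (\<lambda>i. (cmod (cinner x (f i)))\<^sup>2) summable_on I \<and>
        A * (norm x)\<^sup>2 \<le> (\<Sum>\<^sub>\<infinity>i\<in>I. (cmod (cinner x (f i)))\<^sup>2) \<and>
        (\<Sum>\<^sub>\<infinity>i\<in>I. (cmod (cinner x (f i)))\<^sup>2) \<le> B * (norm x)\<^sup>2)"

definition is_frame :: "'i set \<Rightarrow> ('i \<Rightarrow> 'h::complex_hilbert) \<Rightarrow> 'h set \<Rightarrow> bool" where
  "is_frame I f K \<longleftrightarrow> (\<exists>A>0. \<exists>B>0. frame_with_bounds A B I f K)"

definition normalized_tight_frame ::
    "'i set \<Rightarrow> ('i \<Rightarrow> 'h::complex_hilbert) \<Rightarrow> 'h set \<Rightarrow> bool" where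
  "normalized_tight_frame I f K \<longleftrightarrow> frame_with_bounds 1 1 I f K"

definition closed_cspan :: "'h::complex_hilbert set \<Rightarrow> 'h set" where
  "closed_cspan S = closure (cspan S)"

text \<open>
  The family \<open>\<pi> g w\<close> is indexed by the pairs \<open>(g, w)\<close>, so that a vector hit by
  several pairs is counted with its multiplicity.
\<close>

abbreviation orbit_index :: "('g, 'b) monoid_scheme \<Rightarrow> 'h set \<Rightarrow> ('g \<times> 'h) set" where
  "orbit_index G W \<equiv> carrier G \<times> W"

abbreviation orbit_family :: "('g \<Rightarrow> 'h \<Rightarrow> 'h) \<Rightarrow> 'g \<times> 'h \<Rightarrow> 'h" where
  "orbit_family \<pi> \<equiv> (\<lambda>(g, w). \<pi> g w)"

definition generated_subspace ::
    "('g, 'b) monoid_scheme \<Rightarrow> ('g \<Rightarrow> 'h::complex_hilbert \<Rightarrow> 'h) \<Rightarrow> 'h set \<Rightarrow> 'h set" where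
  "generated_subspace G \<pi> W = closed_cspan (orbit_family \<pi> ` orbit_index G W)"

definition wandering_frame_collection ::
    "('g, 'b) monoid_scheme \<Rightarrow> ('g \<Rightarrow> 'h::complex_hilbert \<Rightarrow> 'h) \<Rightarrow> 'h set \<Rightarrow> bool" where
  "wandering_frame_collection G \<pi> W \<longleftrightarrow>
     finite W \<and> is_frame (orbit_index G W) (orbit_family \<pi>) (generated_subspace G \<pi> W)"

definition complete_wandering_frame_collection ::
    "('g, 'b) monoid_scheme \<Rightarrow> ('g \<Rightarrow> 'h::complex_hilbert \<Rightarrow> 'h) \<Rightarrow> 'h set \<Rightarrow> bool" where
  "complete_wandering_frame_collection G \<pi> W \<longleftrightarrow>
     wandering_frame_collection G \<pi> W \<and> is_frame (orbit_index G W) (orbit_family \<pi>) UNIV"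

definition complementary ::
    "('g, 'b) monoid_scheme \<Rightarrow> ('g \<Rightarrow> 'h::complex_hilbert \<Rightarrow> 'h) \<Rightarrow> 'h set \<Rightarrow> 'h set \<Rightarrow> bool" where
  "complementary G \<pi> X Y \<longleftrightarrow>
     wandering_frame_collection G \<pi> X \<and> wandering_frame_collection G \<pi> Y \<and>
     complete_wandering_frame_collection G \<pi> (X \<union> Y)"

end

theory Submission imports Defs begin

text \<open>
  Let \<open>K\<close> be the subspace generated by \<open>Y\<close>. Projecting a collection \<open>Z\<close> complementary to \<open>Y\<close> onto
  \<open>K\<^sup>\<bottom>\<close>, which is invariant, yields a frame for \<open>K\<^sup>\<bottom>\<close> generated by at most \<open>card Z\<close> vectors;
  conversely, vectors whose orbits form a frame for \<open>K\<^sup>\<bottom>\<close> are complementary to \<open>Y\<close>. So \<open>k\<close> is the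
  least number of vectors whose orbits form a frame for \<open>K\<^sup>\<bottom>\<close>. If \<open>S\<close> denotes the frame operator on
  \<open>K\<^sup>\<bottom>\<close> of such a minimal collection, then \<open>S\<^bsup>-1/2\<^esup>\<close> commutes with the representation and is
  injective, so it turns the collection into a normalized tight one of the same cardinality.
  Both the inverse of \<open>S\<close> and its square root are obtained
  from Banach's fixed point theorem, and the orthogonal projection onto a subspace with a frame
  from the inverse of \<open>S\<close>.
\<close>

section \<open>Complex inner products\<close>

instance complex_hilbert \<subseteq> banach ..

lemma cinner_diff_left: "cinner (x - y) z = cinner x z - cinner y (z::'a::complex_hilbert)"
  using cinner_add_left[of "x - y" y z] by (simp add: algebra_simps)

lemma cinner_zero_left [simp]: "cinner 0 (z::'a::complex_hilbert) = 0"
  using cinner_diff_left[of z z z] by simp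

lemma cinner_zero_right [simp]: "cinner (z::'a::complex_hilbert) 0 = 0"
  using cinner_commute[of z 0] by simp

lemma cinner_add_right: "cinner z (x + y) = cinner z x + cinner (z::'a::complex_hilbert) y"
  by (metis cinner_add_left cinner_commute complex_cnj_add)

lemma cinner_diff_right: "cinner z (x - y) = cinner z x - cinner (z::'a::complex_hilbert) y"
  by (metis cinner_diff_left cinner_commute complex_cnj_diff)

lemma cinner_cscale_right: "cinner x (a *c y) = cnj a * cinner x (y::'a::complex_hilbert)"
  by (metis cinner_cscale_left cinner_commute complex_cnj_mult)

lemma cinner_sum_left: "cinner (\<Sum>i\<in>F. f i) y = (\<Sum>i\<in>F. cinner (f i) (y::'a::complex_hilbert))"
  by (induction F rule: infinite_finite_induct) (auto simp: cinner_add_left)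

text \<open>The real and the complex inner product are tied together by the norm they both induce.
  Expanding the squared norm of \<open>x + y\<close> with each of them identifies the cross
  terms.\<close>

lemma inner_eq_Re_cinner: "inner x y = Re (cinner x (y::'a::complex_hilbert))"
proof -
  have "complex_of_real ((norm (x + y))\<^sup>2) = 
      complex_of_real ((norm x)\<^sup>2) + complex_of_real ((norm y)\<^sup>2) + (cinner x y + cnj (cinner x y))"
    unfolding cinner_self[symmetric] cinner_commute[of y x, symmetric]
    by (simp add: cinner_add_left cinner_add_right)
  then have "(norm (x + y))\<^sup>2 = (norm x)\<^sup>2 + (norm y)\<^sup>2 + 2 * Re (cinner x y)"
    by (auto simp: complex_eq_iff)
  then show ?thesis by (simp add: dot_norm)
qed

lemma norm_cscale: "norm (a *c x) = cmod a * norm (x::'a::complex_hilbert)"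
proof -
  have "complex_of_real ((norm (a *c x))\<^sup>2) = (a * cnj a) * complex_of_real ((norm x)\<^sup>2)"
    by (simp only: cinner_self[symmetric]) (simp add: cinner_cscale_left cinner_cscale_right)
  also have "\<dots> = complex_of_real ((cmod a * norm x)\<^sup>2)"
    by (simp add: complex_norm_square[symmetric] power_mult_distrib del: of_real_power)
  finally have "(norm (a *c x))\<^sup>2 = (cmod a * norm x)\<^sup>2"
    by (simp only: of_real_eq_iff)
  then show ?thesis by (simp add: power2_eq_iff_nonneg)
qed

text \<open>Rotating \<open>x\<close> by a unimodular scalar makes the complex inner product real
  and nonnegative, so the real Cauchy-Schwarz inequality applies.\<close>

lemma cmod_cinner_le: "cmod (cinner x y) \<le> norm x * norm (y::'a::complex_hilbert)"
proof (cases "cinner x y = 0")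
  case False
  define a where "a = cnj (sgn (cinner x y))"
  have a: "a * cinner x y = of_real (cmod (cinner x y))" "cmod a = 1"
    using False complex_norm_square[of "cinner x y"]
    by (auto simp: a_def norm_sgn sgn_eq norm_divide power2_eq_square field_simps)
  have "cmod (cinner x y) = inner (a *c x) y"
    by (simp add: inner_eq_Re_cinner cinner_cscale_left a)
  also have "\<dots> \<le> norm (a *c x) * norm y" by (rule norm_cauchy_schwarz)
  finally show ?thesis by (simp add: norm_cscale a)
qed simp

lemma scaleR_eq_cscale: "r *\<^sub>R x = complex_of_real r *c (x::'a::complex_hilbert)"
  by (simp add: cscale_of_real)

lemma bounded_linear_cinner_left: "bounded_linear (\<lambda>x. cinner x (y::'a::complex_hilbert))"
  by (rule bounded_linear_intro[where K = "norm y"])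
    (auto simp: cinner_add_left cinner_cscale_left scaleR_eq_cscale scaleR_conv_of_real cmod_cinner_le)

lemma bounded_linear_cinner_right: "bounded_linear (\<lambda>y. cinner (x::'a::complex_hilbert) y)"
  by (rule bounded_linear_intro[where K = "norm x"])
    (use cmod_cinner_le[of x] in \<open>auto simp: cinner_add_right cinner_cscale_right scaleR_eq_cscale
      scaleR_conv_of_real mult.commute\<close>)

lemma bounded_linear_cscale: "bounded_linear (\<lambda>x. a *c (x::'a::complex_hilbert))"
  by (rule bounded_linear_intro[where K = "cmod a"])
    (auto simp: cscale_add_right scaleR_eq_cscale cscale_cscale mult.commute norm_cscale)

text \<open>Cauchy criterion: finite sums of \<open>f\<close> over indices outside a large finite
  set are controlled by the tail of the summable family \<open>a\<close>. This covers frame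
  expansions, which converge unconditionally but in general not absolutely.\<close>

lemma summable_on_if_norm_sum_square_le:
  fixes f :: "'i \<Rightarrow> 'a::banach"
  assumes a: "a summable_on I" "\<And>i. i \<in> I \<Longrightarrow> 0 \<le> (a i::real)"
    and le: "\<And>F. finite F \<Longrightarrow> F \<subseteq> I \<Longrightarrow> (norm (sum f F))\<^sup>2 \<le> B * sum a F"
  shows "f summable_on I"
proof -
  \<comment> \<open>\<open>B\<close> may be zero or negative; the maximum gives a positive constant
    to divide by.\<close>
  define C where "C = max B 1"
  have C: "C > 0" "(norm (sum f F))\<^sup>2 \<le> C * sum a F" if "finite F" "F \<subseteq> I" for F
    using le[OF that] mult_right_mono[of B C "sum a F"] a(2) that
    by (force simp: C_def intro!: sum_nonneg)+
  have "cauchy_filter (filtermap (sum f) (finite_subsets_at_top I))"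
    unfolding cauchy_filter_metric_filtermap
  proof (intro allI impI)
    fix e :: real assume e: "e > 0"
    \<comment> \<open>Chosen so that \<open>C * d\<close> is the square of \<open>e / 2\<close>.
      Since \<open>F\<close> exhausts the sum of \<open>a\<close> up to \<open>d / 3\<close>,
      everything disjoint from \<open>F\<close> sums to less than \<open>d\<close>.\<close>
    define d where "d = e\<^sup>2 / (4 * C)"
    have d: "d > 0" using e C(1)[of "{}"] by (simp add: d_def)
    obtain F where F: "finite F" "F \<subseteq> I" "dist (sum a F) (infsum a I) \<le> d / 3"
      using has_sum_finite_approximation[OF has_sum_infsum[OF a(1)], of "d / 3"] d by auto
    have small: "norm (sum f (E - F)) < e / 2" if E: "finite E" "F \<subseteq> E" "E \<subseteq> I" for E
    proof -
      have "sum a E \<le> infsum a I"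
        using a E by (intro finite_sum_le_infsum) auto
      moreover have "sum a E = sum a F + sum a (E - F)"
        using E by (metis add.commute sum.subset_diff)
      ultimately have "sum a (E - F) < d"
        using F(3) d unfolding dist_real_def by linarith
      moreover have "(norm (sum f (E - F)))\<^sup>2 \<le> C * sum a (E - F)"
        using E by (intro C) auto
      ultimately have "(norm (sum f (E - F)))\<^sup>2 < C * d"
        using C(1)[of "{}"] by (meson le_less_trans mult_strict_left_mono empty_subsetI finite.emptyI)
      also have "C * d = (e / 2)\<^sup>2"
        using C(1)[of "{}"] by (simp add: d_def field_simps power2_eq_square)
      finally show ?thesis using power_less_imp_less_base[of _ 2 "e / 2"] e by simp
    qed
    define P where "P E \<longleftrightarrow> finite E \<and> F \<subseteq> E \<and> E \<subseteq> I" for E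
    have "eventually P (finite_subsets_at_top I)"
      using F by (auto simp: eventually_finite_subsets_at_top P_def)
    moreover have "dist (sum f F1) (sum f F2) < e" if "P F1" "P F2" for F1 F2
    proof -
      \<comment> \<open>Both index sets contain \<open>F\<close>, whose contribution cancels; only
        the two small remainders survive.\<close>
      have "sum f F1 - sum f F2 = sum f (F1 - F) - sum f (F2 - F)"
        using that by (simp add: P_def sum_diff)
      then have "dist (sum f F1) (sum f F2) \<le> norm (sum f (F1 - F)) + norm (sum f (F2 - F))"
        by (simp add: dist_norm norm_triangle_ineq4)
      also have "\<dots> < e"
        using small[of F1] small[of F2] that by (auto simp: P_def)
      finally show ?thesis .
    qed
    ultimately show "\<exists>P. eventually P (finite_subsets_at_top I) \<and>
        (\<forall>x y. P x \<and> P y \<longrightarrow> dist (sum f x) (sum f y) < e)"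
      by blast
  qed
  moreover have "complete (UNIV :: 'a set)"
    by (meson Cauchy_convergent UNIV_I complete_def convergent_def)
  ultimately obtain L where "(sum f \<longlongrightarrow> L) (finite_subsets_at_top I)"
    using complete_uniform[where S = "UNIV :: 'a set"] by (force simp: filterlim_def)
  then show ?thesis
    by (auto simp: summable_on_def has_sum_def)
qed

text \<open>Duality: a Bessel bound for the analysis coefficients of the combination itself bounds
  its norm. Pairing the combination \<open>?z\<close> with itself and applying Cauchy-Schwarz bounds
  the fourth power of its norm, and one factor \<open>(norm ?z)\<^sup>2\<close> cancels.\<close>

lemma norm_sum_square_le_Bessel:
  fixes f :: "'i \<Rightarrow> 'h::complex_hilbert"
  assumes "0 \<le> B"
    and bessel: "(\<Sum>i\<in>F. (cmod (cinner (\<Sum>i\<in>F. c i *c f i) (f i)))\<^sup>2)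
      \<le> B * (norm (\<Sum>i\<in>F. c i *c f i))\<^sup>2"
  shows "(norm (\<Sum>i\<in>F. c i *c f i))\<^sup>2 \<le> B * (\<Sum>i\<in>F. (cmod (c i))\<^sup>2)"
proof -
  let ?z = "\<Sum>i\<in>F. c i *c f i"
  have "complex_of_real ((norm ?z)\<^sup>2) = (\<Sum>i\<in>F. c i * cinner (f i) ?z)"
    unfolding cinner_self[symmetric] by (simp add: cinner_sum_left cinner_cscale_left)
  then have "(norm ?z)\<^sup>2 = cmod (\<Sum>i\<in>F. c i * cinner (f i) ?z)"
    by (metis abs_of_nonneg norm_of_real zero_le_power2)
  also have "\<dots> \<le> (\<Sum>i\<in>F. cmod (c i) * cmod (cinner ?z (f i)))"
    by (rule order_trans[OF norm_sum])
      (simp add: norm_mult cinner_commute[of "f _" ?z])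
  finally have "((norm ?z)\<^sup>2)\<^sup>2 \<le> (\<Sum>i\<in>F. cmod (c i) * cmod (cinner ?z (f i)))\<^sup>2"
    by (intro power_mono) auto
  also have "\<dots> \<le> (\<Sum>i\<in>F. (cmod (c i))\<^sup>2) * (\<Sum>i\<in>F. (cmod (cinner ?z (f i)))\<^sup>2)"
    by (rule Cauchy_Schwarz_ineq_sum)
  also have "\<dots> \<le> (\<Sum>i\<in>F. (cmod (c i))\<^sup>2) * (B * (norm ?z)\<^sup>2)"
    by (intro mult_left_mono bessel sum_nonneg) auto
  finally have *: "(norm ?z)\<^sup>2 * (norm ?z)\<^sup>2 \<le> (B * (\<Sum>i\<in>F. (cmod (c i))\<^sup>2)) * (norm ?z)\<^sup>2"
    by (simp add: power2_eq_square algebra_simps)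
  show ?thesis
  proof (cases "?z = 0")
    case True
    then show ?thesis using assms(1) by (simp add: sum_nonneg)
  next
    case False
    then show ?thesis using * by (simp only: mult_le_cancel_right) auto
  qed
qed

section \<open>The frame operator and its square root\<close>

lemma subspace_scaleR:
  "complex_vector.subspace M \<Longrightarrow> x \<in> M \<Longrightarrow> r *\<^sub>R x \<in> (M::'h::complex_hilbert set)"
  by (simp add: scaleR_eq_cscale complex_vector.subspace_scale)

text \<open>Requiring \<open>A \<le> B\<close> keeps \<open>1 - A / B\<close> nonnegative also when
  \<open>M\<close> is the zero space, where the frame inequalities do not relate the two
  bounds.\<close>

locale closed_subspace_frame =
  fixes A B :: real and I :: "'i set" and f :: "'i \<Rightarrow> 'h::complex_hilbert" and M :: "'h set"
  assumes bounds: "0 < A" "A \<le> B"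
    and frame: "frame_with_bounds A B I f M"
    and closed: "closed M"
    and subspace: "complex_vector.subspace M"
begin

lemma B_pos: "0 < B"
  using bounds by simp

lemmas subspace_closed_under =
  complex_vector.subspace_add[OF subspace] complex_vector.subspace_diff[OF subspace]
  complex_vector.subspace_scale[OF subspace] complex_vector.subspace_0[OF subspace]
  subspace_scaleR[OF subspace]
  complex_vector.subspace_sum[OF subspace]

lemma f_in: "i \<in> I \<Longrightarrow> f i \<in> M"
  using frame by (auto simp: frame_with_bounds_def)

lemma norm_synthesis_le:
  assumes "finite F" "F \<subseteq> I"
  shows "(norm (\<Sum>i\<in>F. c i *c f i))\<^sup>2 \<le> B * (\<Sum>i\<in>F. (cmod (c i))\<^sup>2)"
proof (rule norm_sum_square_le_Bessel)
  let ?z = "\<Sum>i\<in>F. c i *c f i"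
  have "?z \<in> M"
    using assms f_in by (intro subspace_closed_under) auto
  then have *: "(\<lambda>i. (cmod (cinner ?z (f i)))\<^sup>2) summable_on I"
    "(\<Sum>\<^sub>\<infinity>i\<in>I. (cmod (cinner ?z (f i)))\<^sup>2) \<le> B * (norm ?z)\<^sup>2"
    using frame by (auto simp: frame_with_bounds_def)
  show "(\<Sum>i\<in>F. (cmod (cinner ?z (f i)))\<^sup>2) \<le> B * (norm ?z)\<^sup>2"
    using finite_sum_le_infsum[OF *(1) assms] *(2) by simp
qed (use bounds in simp)

text \<open>The frame inequality is given for vectors of \<open>M\<close> only. For arbitrary
  \<open>u\<close> the coefficient sum \<open>s\<close> is the inner product of the synthesized
  vector \<open>z\<close> with \<open>u\<close>, so the synthesis bound gives the same constant
  before any projection onto \<open>M\<close> is available.\<close>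

lemma Bessel:
  assumes "finite F" "F \<subseteq> I"
  shows "(\<Sum>i\<in>F. (cmod (cinner u (f i)))\<^sup>2) \<le> B * (norm u)\<^sup>2"
proof -
  define s where "s = (\<Sum>i\<in>F. (cmod (cinner u (f i)))\<^sup>2)"
  define z where "z = (\<Sum>i\<in>F. cinner u (f i) *c f i)"
  have "cinner z u = (\<Sum>i\<in>F. cinner u (f i) * cnj (cinner u (f i)))"
    by (simp add: z_def cinner_sum_left cinner_cscale_left cinner_commute[of "f _" u])
  also have "\<dots> = complex_of_real s"
    by (simp add: s_def complex_norm_square del: of_real_power)
  finally have "s \<le> norm z * norm u"
    using cmod_cinner_le[of z u] by simp
  moreover have s0: "0 \<le> s" by (simp add: s_def sum_nonneg)
  ultimately have "s\<^sup>2 \<le> (norm z)\<^sup>2 * (norm u)\<^sup>2"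
    by (metis power_mono power_mult_distrib)
  also have "\<dots> \<le> (B * s) * (norm u)\<^sup>2"
    using norm_synthesis_le[OF assms, of "\<lambda>i. cinner u (f i)"]
    by (intro mult_right_mono) (auto simp: z_def s_def)
  finally have "s * s \<le> (B * (norm u)\<^sup>2) * s"
    by (simp add: power2_eq_square algebra_simps)
  then have "s \<le> B * (norm u)\<^sup>2"
    using s0 B_pos by (cases "s = 0") auto
  then show ?thesis by (simp add: s_def)
qed

section \<open>The frame operator and its quadratic form\<close>

lemma coefficients_summable: "(\<lambda>i. (cmod (cinner u (f i)))\<^sup>2) summable_on I"
  by (rule nonneg_bdd_above_summable_on) (use Bessel in \<open>auto simp: bdd_above_def\<close>)

text \<open>The frame operator, taken on the whole space with values in \<open>M\<close>; its values
  off \<open>M\<close> are what yields the orthogonal projection.\<close>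

definition S :: "'h \<Rightarrow> 'h" where
  "S u = (\<Sum>\<^sub>\<infinity>i\<in>I. cinner u (f i) *c f i)"

lemma has_sum_S: "((\<lambda>i. cinner u (f i) *c f i) has_sum S u) I"
  unfolding S_def
  by (intro has_sum_infsum summable_on_if_norm_sum_square_le[OF coefficients_summable[of u]])
    (use norm_synthesis_le in auto)

lemma S_eqI: "((\<lambda>i. cinner u (f i) *c f i) has_sum v) I \<Longrightarrow> S u = v"
  unfolding S_def by (rule infsumI)

lemma S_add: "S (u + v) = S u + S v"
  by (rule S_eqI) (use has_sum_add[OF has_sum_S has_sum_S] in
      \<open>simp add: cinner_add_left cscale_add_left\<close>)

lemma S_cscale: "S (a *c u) = a *c S u"
  by (rule S_eqI) (use has_sum_bounded_linear[OF bounded_linear_cscale has_sum_S] in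
      \<open>simp add: cinner_cscale_left cscale_cscale\<close>)

lemma S_scaleR: "S (r *\<^sub>R u) = r *\<^sub>R S u"
  by (simp add: scaleR_eq_cscale S_cscale)

lemma S_diff: "S (u - v) = S u - S v"
  using S_add[of "u - v" v] by simp

lemma S_in: "S u \<in> M"
  using has_sum_S[of u] unfolding has_sum_def
proof (rule Lim_in_closed_set[OF closed, rotated 2])
  show "\<forall>\<^sub>F F in finite_subsets_at_top I. (\<Sum>i\<in>F. cinner u (f i) *c f i) \<in> M"
    by (rule eventually_finite_subsets_at_top_weakI)
      (use f_in in \<open>auto intro!: subspace_closed_under\<close>)
qed simp

lemma cinner_S_right: "((\<lambda>i. cinner u (f i) * cnj (cinner v (f i))) has_sum cinner u (S v)) I"
  using has_sum_bounded_linear[OF bounded_linear_cinner_right has_sum_S[of v], of u]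
  by (simp add: cinner_cscale_right mult.commute)

lemma cinner_S_left: "((\<lambda>i. cinner u (f i) * cnj (cinner v (f i))) has_sum cinner (S u) v) I"
  using has_sum_bounded_linear[OF bounded_linear_cinner_left has_sum_S[of u], of v]
  by (simp add: cinner_cscale_left cinner_commute[of "f _" v])

lemma S_selfadjoint: "cinner (S u) v = cinner u (S v)"
  using cinner_S_left cinner_S_right by (rule has_sum_unique)

lemma cinner_S_self:
  "cinner (S u) u = complex_of_real (\<Sum>\<^sub>\<infinity>i\<in>I. (cmod (cinner u (f i)))\<^sup>2)"
proof (rule has_sum_unique[OF cinner_S_left])
  show "((\<lambda>i. cinner u (f i) * cnj (cinner u (f i))) has_sum
      complex_of_real (\<Sum>\<^sub>\<infinity>i\<in>I. (cmod (cinner u (f i)))\<^sup>2)) I"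
    using has_sum_of_real[OF has_sum_infsum[OF coefficients_summable[of u]], where 'a = complex]
    by (simp add: complex_norm_square[symmetric] del: of_real_power)
qed

lemma inner_S_self: "inner (S u) u = (\<Sum>\<^sub>\<infinity>i\<in>I. (cmod (cinner u (f i)))\<^sup>2)"
  by (simp add: inner_eq_Re_cinner cinner_S_self)

lemma inner_S_bounds:
  assumes "u \<in> M"
  shows "A * (norm u)\<^sup>2 \<le> inner (S u) u" "inner (S u) u \<le> B * (norm u)\<^sup>2"
  using assms frame unfolding inner_S_self frame_with_bounds_def by auto

section \<open>Inverting the frame operator by a contraction\<close>

definition T :: "'h \<Rightarrow> 'h" where "T u = u - (1 / B) *\<^sub>R S u"

text \<open>On \<open>M\<close> the quadratic form of \<open>S\<close> lies between those of
  \<open>A\<close> and \<open>B\<close>, so the form of \<open>T\<close> lies between those of 0 and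
  \<open>\<theta>\<close>.\<close>

definition \<theta> :: real where "\<theta> = 1 - A / B"

lemma \<theta>: "0 \<le> \<theta>" "\<theta> < 1"
  using bounds B_pos by (auto simp: \<theta>_def)

lemma T_in: "u \<in> M \<Longrightarrow> T u \<in> M"
  by (simp add: T_def subspace_closed_under S_in)

lemma T_add: "T (u + v) = T u + T v"
  by (simp add: T_def S_add algebra_simps)

lemma T_scaleR: "T (r *\<^sub>R u) = r *\<^sub>R T u"
  by (simp add: T_def S_scaleR algebra_simps)

lemma T_diff: "T (u - v) = T u - T v"
  by (simp add: T_def S_diff algebra_simps)

lemma T_selfadjoint: "cinner (T u) v = cinner u (T v)"
  by (simp add: T_def cinner_diff_left cinner_diff_right scaleR_eq_cscale cinner_cscale_left
      cinner_cscale_right S_selfadjoint)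

text \<open>The norm of the positive operator \<open>T\<close> is read off its quadratic form by polarization.\<close>

lemma norm_T_le:
  assumes "u \<in> M"
  shows "norm (T u) \<le> \<theta> * norm u"
proof (cases "T u = 0 \<or> u = 0")
  case True
  then show ?thesis
    using \<theta> T_diff[of u u] by auto
next
  case False
  define w where "w = T u"
  \<comment> \<open>This scaling gives \<open>s *\<^sub>R w\<close> the same norm as
    \<open>u\<close>, so the triangle inequality below bounds the norm of their sum by twice the
    norm of \<open>u\<close>.\<close>
  define s where "s = norm u / norm w"
  have s: "s > 0" "s * norm w = norm u" using False by (auto simp: s_def w_def)
  have w: "w \<in> M" using assms T_in by (simp add: w_def)
  have q: "0 \<le> inner (T v) v" "inner (T v) v \<le> \<theta> * (norm v)\<^sup>2" if "v \<in> M" for v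
  proof -
    have "inner (T v) v = (norm v)\<^sup>2 - inner (S v) v / B"
      by (simp add: T_def inner_diff_left power2_norm_eq_inner)
    moreover have "inner (S v) v / B \<le> (norm v)\<^sup>2" "A / B * (norm v)\<^sup>2 \<le> inner (S v) v / B"
      using inner_S_bounds[OF that] B_pos by (auto simp: field_simps)
    ultimately show "0 \<le> inner (T v) v" "inner (T v) v \<le> \<theta> * (norm v)\<^sup>2"
      by (auto simp: \<theta>_def left_diff_distrib)
  qed
  have sym: "inner (T v) u = inner v (T u)" for v u
    by (simp add: inner_eq_Re_cinner T_selfadjoint)
  have "4 * (s * (norm w)\<^sup>2) = 4 * inner (T u) (s *\<^sub>R w)"
    by (simp add: w_def power2_norm_eq_inner)
  also have "\<dots> = inner (T (u + s *\<^sub>R w)) (u + s *\<^sub>R w) - inner (T (u - s *\<^sub>R w)) (u - s *\<^sub>R w)"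
    using sym[of w u] by (simp add: T_add T_diff T_scaleR inner_add_left inner_add_right inner_diff_left inner_diff_right
        inner_commute algebra_simps)
  \<comment> \<open>Positivity of the form of \<open>T\<close> allows the subtracted term to be
    dropped.\<close>
  also have "\<dots> \<le> \<theta> * (norm (u + s *\<^sub>R w))\<^sup>2"
    using q(1)[of "u - s *\<^sub>R w"] q(2)[of "u + s *\<^sub>R w"] assms w
    by (simp add: subspace_closed_under)
  also have "\<dots> \<le> \<theta> * (norm u + s * norm w)\<^sup>2"
    using norm_triangle_ineq[of u "s *\<^sub>R w"] s \<theta>
    by (intro mult_left_mono power_mono) auto
  also have "\<dots> = 4 * (\<theta> * norm u * norm u)"
    by (simp add: s(2) power2_eq_square)
  finally have "(s * norm w) * norm w \<le> (\<theta> * norm u) * norm u"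
    by (simp add: power2_eq_square algebra_simps)
  then have "norm w * norm u \<le> (\<theta> * norm u) * norm u"
    by (simp add: s(2) mult.commute)
  then show ?thesis
    using False by (simp add: w_def)
qed

text \<open>Solving \<open>S z = v\<close> amounts to finding a fixed point of
  \<open>T z + (1 / B) *\<^sub>R v\<close>, which is a contraction of the complete set
  \<open>M\<close> with constant \<open>\<theta>\<close>.\<close>

lemma S_surj:
  assumes v: "v \<in> M"
  shows "\<exists>z\<in>M. S z = v"
proof -
  let ?\<phi> = "\<lambda>z. T z + (1 / B) *\<^sub>R v"
  have "\<exists>!z\<in>M. ?\<phi> z = z"
  proof (rule Banach_fix[OF _ _ \<theta>])
    show "complete M" using closed by (simp add: complete_eq_closed)
    show "M \<noteq> {}" using v by auto
    show "?\<phi> ` M \<subseteq> M" using v by (auto intro!: subspace_closed_under T_in)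
    show "dist (?\<phi> x) (?\<phi> y) \<le> \<theta> * dist x y" if "x \<in> M" "y \<in> M" for x y
      using norm_T_le[of "x - y"] that
      by (simp add: dist_norm T_diff subspace_closed_under)
  qed
  then obtain z where "z \<in> M" "(1 / B) *\<^sub>R v = (1 / B) *\<^sub>R S z"
    by (auto simp: T_def algebra_simps)
  then show ?thesis using B_pos by auto
qed

section \<open>The orthogonal projection onto \<open>M\<close>\<close>

lemma ex_projection: "\<exists>p\<in>M. \<forall>v\<in>M. cinner (u - p) v = 0"
proof -
  \<comment> \<open>The difference \<open>u - p\<close> is killed by the self-adjoint operator
    \<open>S\<close>, hence is orthogonal to its range, which is all of \<open>M\<close>.\<close>
  obtain p where p: "p \<in> M" "S p = S u"
    using S_surj[OF S_in] by blast
  have "cinner (u - p) v = 0" if v: "v \<in> M" for v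
  proof -
    obtain z where "v = S z" using S_surj[OF v] by blast
    then show ?thesis by (simp add: S_selfadjoint[symmetric] S_diff p)
  qed
  then show ?thesis using p by blast
qed

definition P :: "'h \<Rightarrow> 'h" where
  "P u = (SOME p. p \<in> M \<and> (\<forall>v\<in>M. cinner (u - p) v = 0))"

lemma P: "P u \<in> M" "v \<in> M \<Longrightarrow> cinner (u - P u) v = 0"
  using someI_ex[of "\<lambda>p. p \<in> M \<and> (\<forall>v\<in>M. cinner (u - p) v = 0)"] ex_projection[of u]
  unfolding P_def by blast+

lemma P_eqI:
  assumes "p \<in> M" "\<And>v. v \<in> M \<Longrightarrow> cinner (u - p) v = 0"
  shows "P u = p"
proof -
  have d: "P u - p \<in> M" using P assms by (intro subspace_closed_under) auto
  have "cinner (P u - p) (P u - p) = cinner (u - p) (P u - p) - cinner (u - P u) (P u - p)"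
    by (simp add: cinner_diff_left)
  also have "\<dots> = 0" using P(2)[OF d] assms(2)[OF d] by simp
  finally show ?thesis by (simp add: cinner_self)
qed

lemma P_ident: "u \<in> M \<Longrightarrow> P u = u"
  by (rule P_eqI) auto

lemma norm_P_le: "norm (P u) \<le> norm u"
proof -
  have "inner (u - P u) (P u) = 0"
    by (simp add: inner_eq_Re_cinner P)
  then have "(norm (P u))\<^sup>2 = inner u (P u)"
    by (simp add: inner_diff_left power2_norm_eq_inner)
  also have "\<dots> \<le> norm u * norm (P u)" by (rule norm_cauchy_schwarz)
  finally show ?thesis
    by (cases "norm (P u) = 0") (auto simp: power2_eq_square)
qed

lemma bounded_linear_P: "bounded_linear P"
proof (rule bounded_linear_intro[where K = 1])
  show "P (u + v) = P u + P v" for u v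
  proof (rule P_eqI)
    show "P u + P v \<in> M" by (intro subspace_closed_under P)
    show "cinner (u + v - (P u + P v)) w = 0" if "w \<in> M" for w
      using P(2)[OF that] by (simp only: add_diff_add cinner_add_left) simp
  qed
  show "P (r *\<^sub>R u) = r *\<^sub>R P u" for r u
  proof (rule P_eqI)
    show "r *\<^sub>R P u \<in> M" by (intro subspace_closed_under P)
    show "cinner (r *\<^sub>R u - r *\<^sub>R P u) v = 0" if "v \<in> M" for v
      using P(2)[OF that, of u]
      by (simp only: scaleR_diff_right[symmetric]) (simp add: scaleR_eq_cscale cinner_cscale_left)
  qed
  show "norm (P u) \<le> norm u * 1" for u
    using norm_P_le by simp
qed

section \<open>The square root of the frame operator\<close>

lemma bounded_linear_TP: "bounded_linear (\<lambda>u. T (P u))"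
  and norm_TP_le: "norm (T (P u)) \<le> \<theta> * norm u"
proof -
  interpret P: bounded_linear P by (rule bounded_linear_P)
  show *: "norm (T (P u)) \<le> \<theta> * norm u" for u
    using norm_T_le[OF P(1)[of u]] norm_P_le \<theta> mult_left_mono order_trans by blast
  show "bounded_linear (\<lambda>u. T (P u))"
    by (rule bounded_linear_intro[where K = \<theta>])
      (use * in \<open>auto simp: P.add P.scaleR T_add T_scaleR mult.commute\<close>)
qed

text \<open>\<open>1 - X\<close> is a square root of \<open>S / B = 1 - T\<close> on \<open>M\<close> iff \<open>X = (T + X\<^sup>2) / 2\<close>. The right hand side
  is a contraction of the operators of norm at most \<open>1 - sqrt (1 - \<theta>)\<close>, and it preserves the closed
  conditions that are imposed on the square root.\<close>

lemma ex_root_operator: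
  assumes \<U>: "\<forall>U\<in>\<U>. bounded_linear U \<and> U ` M \<subseteq> M \<and> (\<forall>u\<in>M. S (U u) = U (S u))"
  shows "\<exists>X. bounded_linear X \<and> (\<forall>u\<in>M. X u \<in> M) \<and>
    (\<forall>u\<in>M. \<forall>v\<in>M. cinner (X u) v = cinner u (X v)) \<and>
    (\<forall>U\<in>\<U>. \<forall>u\<in>M. X (U u) = U (X u)) \<and>
    (\<forall>u\<in>M. 2 *\<^sub>R X u = T u + X (X u))"
proof -
  have U: "bounded_linear U" "u \<in> M \<Longrightarrow> U u \<in> M" "u \<in> M \<Longrightarrow> S (U u) = U (S u)" if "U \<in> \<U>" for U u
    using \<U> that by auto
  \<comment> \<open>The smaller root of \<open>x = (\<theta> + x * x) / 2\<close>. It serves both as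
    the radius of an invariant ball and as the contraction constant.\<close>
  define c where "c = 1 - sqrt (1 - \<theta>)"
  have c: "0 \<le> c" "c < 1"
    using \<theta> by (auto simp: c_def)
  have c_fix: "(\<theta> + c * c) / 2 = c"
    using \<theta> real_sqrt_pow2[of "1 - \<theta>"] by (simp add: c_def power2_eq_square field_simps)
  \<comment> \<open>The iteration lives in the Banach space of bounded operators on the whole space,
    where \<open>T\<close> itself need not have norm below 1. Composing with \<open>P\<close>
    extends the bound \<open>\<theta>\<close> from \<open>M\<close> to all vectors without changing
    \<open>T\<close> on \<open>M\<close>.\<close>
  define T' where "T' = Blinfun (\<lambda>u. T (P u))"
  have T': "T' u = T (P u)" for u
    by (simp add: T'_def bounded_linear_Blinfun_apply bounded_linear_TP)
  have norm_T': "norm T' \<le> \<theta>"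
    by (rule norm_blinfun_bound) (use \<theta> norm_TP_le in \<open>auto simp: T'\<close>)
  define \<Phi> where "\<Phi> X = (1 / 2) *\<^sub>R (T' + (X o\<^sub>L X))" for X
  define s where "s = {X :: 'h \<Rightarrow>\<^sub>L 'h. norm X \<le> c} \<inter> {X :: 'h \<Rightarrow>\<^sub>L 'h. \<forall>u\<in>M. X u \<in> M} \<inter>
    {X :: 'h \<Rightarrow>\<^sub>L 'h. \<forall>u\<in>M. \<forall>v\<in>M. cinner (X u) v = cinner u (X v)} \<inter>
    {X :: 'h \<Rightarrow>\<^sub>L 'h. \<forall>U\<in>\<U>. \<forall>u\<in>M. X (U u) = U (X u)}"
  \<comment> \<open>Evaluation at a fixed vector is continuous for the operator norm, which makes
    the pointwise conditions in \<open>s\<close> closed.\<close>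
  have cont: "continuous_on UNIV (\<lambda>X::'h \<Rightarrow>\<^sub>L 'h. L (X u))" if "bounded_linear L"
    for L :: "'h \<Rightarrow> 'c::real_normed_vector" and u
    by (rule bounded_linear.continuous_on[OF that]) (intro continuous_intros)
  have "closed s"
    unfolding s_def
  proof (intro closed_Int)
    show "closed {X :: 'h \<Rightarrow>\<^sub>L 'h. norm X \<le> c}"
      by (intro closed_Collect_le continuous_intros)
    have "closed {X :: 'h \<Rightarrow>\<^sub>L 'h. X u \<in> M}" for u
      using closed_vimage[OF closed cont[OF bounded_linear_ident, of u]] by (simp add: vimage_def)
    then show "closed {X :: 'h \<Rightarrow>\<^sub>L 'h. \<forall>u\<in>M. X u \<in> M}"
      unfolding Collect_ball_eq by (intro closed_INT ballI)
    have "closed {X :: 'h \<Rightarrow>\<^sub>L 'h. cinner (X u) v = cinner u (X v)}" for u v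
      by (intro closed_Collect_eq cont bounded_linear_cinner_left bounded_linear_cinner_right)
    then show "closed {X :: 'h \<Rightarrow>\<^sub>L 'h. \<forall>u\<in>M. \<forall>v\<in>M. cinner (X u) v = cinner u (X v)}"
      unfolding Collect_ball_eq by (intro closed_INT ballI)
    have "closed {X :: 'h \<Rightarrow>\<^sub>L 'h. X (U u) = U (X u)}" if "U \<in> \<U>" for U u
      using cont[OF bounded_linear_ident] cont[OF U(1)[OF that]] by (intro closed_Collect_eq)
    then show "closed {X :: 'h \<Rightarrow>\<^sub>L 'h. \<forall>U\<in>\<U>. \<forall>u\<in>M. X (U u) = U (X u)}"
      unfolding Collect_ball_eq by (intro closed_INT ballI)
  qed
  have "\<exists>!X\<in>s. \<Phi> X = X"
  proof (rule Banach_fix[OF _ _ c])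
    show "complete s" using \<open>closed s\<close> by (simp add: complete_eq_closed)
    have "U 0 = 0" if "U \<in> \<U>" for U
      using U(1)[OF that] by (simp add: bounded_linear.linear linear_0)
    then have "0 \<in> s" using c by (auto simp: s_def subspace_closed_under)
    then show "s \<noteq> {}" by auto
    have \<Phi>: "\<Phi> X u = (1 / 2) *\<^sub>R (T u + X (X u))" if "u \<in> M" for X u
      using that by (simp add: \<Phi>_def blinfun.bilinear_simps T' P_ident)
    show "\<Phi> ` s \<subseteq> s"
    proof safe
      fix X assume X: "X \<in> s"
      have "norm (\<Phi> X) \<le> (1 / 2) * (norm T' + norm X * norm X)"
        using norm_triangle_ineq[of T' "X o\<^sub>L X"] norm_blinfun_compose[of X X]
        by (simp add: \<Phi>_def)
      also have "\<dots> \<le> (1 / 2) * (\<theta> + c * c)"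
        using X norm_T' c by (intro mult_left_mono add_mono mult_mono) (auto simp: s_def)
      finally have "norm (\<Phi> X) \<le> c" using c_fix by simp
      moreover have "\<Phi> X (U u) = U (\<Phi> X u)" if "U \<in> \<U>" "u \<in> M" for U u
      proof -
        interpret U: bounded_linear U by (rule U(1)[OF that(1)])
        show ?thesis using X that U(2,3)[OF that]
          by (auto simp: \<Phi> s_def U.scaleR U.add U.diff T_def)
      qed
      moreover have "\<Phi> X u \<in> M" if "u \<in> M" for u
        using X that unfolding \<Phi>[OF that]
        by (intro subspace_closed_under T_in) (auto simp: s_def)
      moreover have "cinner (\<Phi> X u) v = cinner u (\<Phi> X v)" if "u \<in> M" "v \<in> M" for u v
      proof -
        have "cinner (X (X u)) v = cinner u (X (X v))"
          using X that by (simp add: s_def)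
        then show ?thesis
          using that by (simp add: \<Phi> scaleR_eq_cscale cinner_cscale_left cinner_cscale_right
              cinner_add_left cinner_add_right T_selfadjoint)
      qed
      ultimately show "\<Phi> X \<in> s"
        by (simp add: s_def)
    qed
    fix X Y assume XY: "X \<in> s" "Y \<in> s"
    \<comment> \<open>The constant \<open>T'\<close> cancels, and the difference of the two squares
      is telescoped in a form that is valid without commutation of \<open>X\<close> and
      \<open>Y\<close>.\<close>
    have "\<Phi> X - \<Phi> Y = (1 / 2) *\<^sub>R ((X o\<^sub>L (X - Y)) + ((X - Y) o\<^sub>L Y))"
      by (rule blinfun_eqI) (simp add: \<Phi>_def blinfun.bilinear_simps algebra_simps)
    then have "norm (\<Phi> X - \<Phi> Y) \<le> (1 / 2) * (norm X * norm (X - Y) + norm (X - Y) * norm Y)"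
      using norm_triangle_ineq[of "X o\<^sub>L (X - Y)" "(X - Y) o\<^sub>L Y"]
        norm_blinfun_compose[of X "X - Y"] norm_blinfun_compose[of "X - Y" Y] by simp
    also have "\<dots> \<le> (1 / 2) * (c * norm (X - Y) + norm (X - Y) * c)"
      using XY by (intro mult_left_mono add_mono mult_right_mono) (auto simp: s_def)
    finally show "dist (\<Phi> X) (\<Phi> Y) \<le> c * dist X Y" by (simp add: dist_norm)
  qed
  then obtain X where X: "X \<in> s" "\<Phi> X = X" by blast
  have "2 *\<^sub>R X u = T u + X (X u)" if "u \<in> M" for u
  proof -
    have "2 *\<^sub>R X u = 2 *\<^sub>R \<Phi> X u" using X by simp
    also have "\<dots> = T u + X (X u)"
      unfolding \<Phi>_def using that by (simp add: blinfun.bilinear_simps T' P_ident)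
    finally show ?thesis .
  qed
  then show ?thesis
    using X(1) by (intro exI[of _ "blinfun_apply X"]) (auto simp: s_def blinfun.bounded_linear_right)
qed

text \<open>With \<open>X\<close> from the fixed point equation, \<open>sqrt B\<close> times
  \<open>1 - X\<close> squares to \<open>B\<close> times \<open>1 - T\<close>, which is
  \<open>S\<close>. Surjectivity on \<open>M\<close> is inherited from \<open>S\<close>. The set
  \<open>\<U>\<close> will be the operators of the representation.\<close>

lemma ex_sqrt_S:
  assumes \<U>: "\<forall>U\<in>\<U>. bounded_linear U \<and> U ` M \<subseteq> M \<and> (\<forall>u\<in>M. S (U u) = U (S u))"
  shows "\<exists>V. bounded_linear V \<and> V ` M = M \<and>
    (\<forall>u\<in>M. \<forall>v\<in>M. cinner (V u) v = cinner u (V v)) \<and>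
    (\<forall>U\<in>\<U>. \<forall>u\<in>M. V (U u) = U (V u)) \<and> (\<forall>u\<in>M. V (V u) = S u)"
proof -
  obtain X where X: "bounded_linear X" "\<And>u. u \<in> M \<Longrightarrow> X u \<in> M"
    "\<And>u v. u \<in> M \<Longrightarrow> v \<in> M \<Longrightarrow> cinner (X u) v = cinner u (X v)"
    "\<And>U u. U \<in> \<U> \<Longrightarrow> u \<in> M \<Longrightarrow> X (U u) = U (X u)"
    "\<And>u. u \<in> M \<Longrightarrow> 2 *\<^sub>R X u = T u + X (X u)"
    using ex_root_operator[OF \<U>] by metis
  interpret X: bounded_linear X by (rule X(1))
  define V where "V u = sqrt B *\<^sub>R (u - X u)" for u
  have V_in: "V u \<in> M" if "u \<in> M" for u
    using that X(2) by (auto simp: V_def intro!: subspace_closed_under)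
  have VV: "V (V u) = S u" if "u \<in> M" for u
  proof -
    have "V (V u) = B *\<^sub>R (u - 2 *\<^sub>R X u + X (X u))"
      using B_pos by (simp add: V_def X.scaleR X.diff algebra_simps scaleR_2)
    also have "\<dots> = B *\<^sub>R (u - T u)" using X(5)[OF that] by (simp add: algebra_simps)
    also have "\<dots> = S u" using B_pos by (simp add: T_def)
    finally show ?thesis .
  qed
  have "M \<subseteq> V ` M"
  proof
    fix v assume "v \<in> M"
    then obtain z where "z \<in> M" "S z = v" using S_surj by blast
    then show "v \<in> V ` M" using VV V_in by (metis imageI)
  qed
  moreover have "bounded_linear V"
    unfolding V_def
    by (intro bounded_linear_const_scaleR bounded_linear_sub bounded_linear_ident X(1))
  moreover have "V (U u) = U (V u)" if "U \<in> \<U>" "u \<in> M" for U u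
  proof -
    interpret U: bounded_linear U using \<U> that by blast
    show ?thesis using that by (simp add: V_def X(4) U.scaleR U.diff)
  qed
  moreover have "cinner (V u) v = cinner u (V v)" if "u \<in> M" "v \<in> M" for u v
    using that by (simp add: V_def scaleR_eq_cscale cinner_cscale_left cinner_cscale_right
        cinner_diff_left cinner_diff_right X(3))
  ultimately show ?thesis
    using V_in VV by (intro exI[of _ V]) auto
qed

text \<open>The family \<open>f' = S\<^bsup>-1/2\<^esup> f\<close>.\<close>

lemma normalized_tight_frame_sqrt:
  assumes V: "V ` M = M" "\<And>u v. u \<in> M \<Longrightarrow> v \<in> M \<Longrightarrow> cinner (V u) v = cinner u (V v)"
    "\<And>u. u \<in> M \<Longrightarrow> V (V u) = S u"
    and f': "\<And>i. i \<in> I \<Longrightarrow> f' i \<in> M" "\<And>i. i \<in> I \<Longrightarrow> V (f' i) = f i"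
  shows "normalized_tight_frame I f' M"
proof -
  have "(\<lambda>i. (cmod (cinner u (f' i)))\<^sup>2) summable_on I \<and>
      (\<Sum>\<^sub>\<infinity>i\<in>I. (cmod (cinner u (f' i)))\<^sup>2) = (norm u)\<^sup>2" if "u \<in> M" for u
  proof -
    \<comment> \<open>Moving \<open>V\<close> across the inner product turns the coefficients of
      \<open>u = V w\<close> against \<open>f'\<close> into those of \<open>w\<close> against
      \<open>f\<close>. Their squares sum to the form of \<open>S\<close> at \<open>w\<close>, which
      is the squared norm of \<open>V w\<close>.\<close>
    obtain w where w: "w \<in> M" "u = V w" using V(1) \<open>u \<in> M\<close> by blast
    have *: "cinner u (f' i) = cinner w (f i)" if "i \<in> I" for i
      using V(2)[OF w(1) f'(1)[OF that]] f'(2)[OF that] w by simp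
    have summable: "(\<lambda>i. (cmod (cinner u (f' i)))\<^sup>2) summable_on I"
      using coefficients_summable[of w] by (rule summable_on_cong[THEN iffD1, rotated]) (simp add: *)
    have "complex_of_real (\<Sum>\<^sub>\<infinity>i\<in>I. (cmod (cinner u (f' i)))\<^sup>2) = cinner (S w) w"
      unfolding cinner_S_self by (auto intro!: infsum_cong simp: *)
    also have "\<dots> = cinner u u"
      using V(2)[of "V w" w] V(3) w \<open>u \<in> M\<close> by simp
    finally show ?thesis
      using summable by (simp add: cinner_self del: of_real_power)
  qed
  then show ?thesis
    using f' by (auto simp: normalized_tight_frame_def frame_with_bounds_def)
qed

end

section \<open>Invariant subspaces\<close>

text \<open>Splits a sum over an orbit index into the contributions of the finitely many
  generators.\<close>

lemma has_sum_Times_finite: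
  fixes F :: "'g \<times> 'x \<Rightarrow> 'a::topological_comm_monoid_add"
  assumes "finite X" "\<And>x. x \<in> X \<Longrightarrow> ((\<lambda>g. F (g, x)) has_sum s x) C"
  shows "(F has_sum (\<Sum>x\<in>X. s x)) (C \<times> X)"
proof -
  have "(F has_sum s x) ((\<lambda>g. (g, x)) ` C)" if "x \<in> X" for x
    using assms(2)[OF that] by (subst has_sum_reindex) (auto simp: inj_on_def o_def)
  then have "(F has_sum (\<Sum>x\<in>X. s x)) (\<Union>x\<in>X. (\<lambda>g. (g, x)) ` C)"
    using assms(1) by (intro sum_has_sum) auto
  also have "(\<Union>x\<in>X. (\<lambda>g. (g, x)) ` C) = C \<times> X" by auto
  finally show ?thesis .
qed

section \<open>Orthogonal complements and closed linear spans\<close>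

definition orthogonal_complement :: "'h::complex_hilbert set \<Rightarrow> 'h set" where
  "orthogonal_complement K = {u. \<forall>v\<in>K. cinner u v = 0}"

lemma subspace_orthogonal_complement: "complex_vector.subspace (orthogonal_complement K)"
  by (rule complex_vector.subspaceI)
    (auto simp: orthogonal_complement_def cinner_add_left cinner_cscale_left)

lemma closed_orthogonal_complement: "closed (orthogonal_complement (K :: 'h::complex_hilbert set))"
proof -
  have "closed {u. cinner u v = 0}" for v :: 'h
    by (intro closed_Collect_eq continuous_intros
        bounded_linear.continuous_on[OF bounded_linear_cinner_left])
  then show ?thesis
    unfolding orthogonal_complement_def Collect_ball_eq by (intro closed_INT ballI)
qed

lemma closed_closed_cspan: "closed (closed_cspan K)"
  by (simp add: closed_cspan_def)

lemma subset_closed_cspan: "K \<subseteq> closed_cspan K"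
  using complex_vector.span_superset[of K] closure_subset[of "cspan K"]
  by (auto simp: closed_cspan_def)

lemma subspace_closed_cspan: "complex_vector.subspace (closed_cspan K)"
proof (rule complex_vector.subspaceI)
  show "0 \<in> closed_cspan K"
    using complex_vector.span_zero closure_subset unfolding closed_cspan_def by blast
  show "x + y \<in> closed_cspan K" if xy: "x \<in> closed_cspan K" "y \<in> closed_cspan K" for x y
  proof -
    obtain a b where ab: "\<And>n. a n \<in> cspan K" "a \<longlonglongrightarrow> x" "\<And>n. b n \<in> cspan K" "b \<longlonglongrightarrow> y"
      using xy unfolding closed_cspan_def closure_sequential by blast
    have "\<forall>n. a n + b n \<in> cspan K"
      using ab complex_vector.span_add by blast
    then show ?thesis
      using tendsto_add[OF ab(2,4)] unfolding closed_cspan_def closure_sequential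
      by (intro exI[of _ "\<lambda>n. a n + b n"]) simp
  qed
  show "c *c x \<in> closed_cspan K" if x: "x \<in> closed_cspan K" for c x
  proof -
    obtain a where a: "\<And>n. a n \<in> cspan K" "a \<longlonglongrightarrow> x"
      using x unfolding closed_cspan_def closure_sequential by blast
    have "\<forall>n. c *c a n \<in> cspan K"
      using a complex_vector.span_scale by blast
    then show ?thesis
      using bounded_linear.tendsto[OF bounded_linear_cscale a(2), of c]
      unfolding closed_cspan_def closure_sequential
      by (intro exI[of _ "\<lambda>n. c *c a n"]) simp
  qed
qed

lemma closed_cspan_minimal:
  assumes "K \<subseteq> M" "closed M" "complex_vector.subspace M"
  shows "closed_cspan K \<subseteq> M"
  unfolding closed_cspan_def
  using assms by (intro closure_minimal complex_vector.span_minimal)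

lemma cinner_eq_0_sym: "cinner x y = 0 \<Longrightarrow> cinner y (x::'h::complex_hilbert) = 0"
  using cinner_commute[of y x] by simp

text \<open>The double complement of \<open>K\<close> is a closed subspace containing
  \<open>K\<close>, hence contains its closed span. Orthogonality to a generated subspace can thus
  be tested on the orbits.\<close>

lemma orthogonal_complement_closed_cspan:
  "orthogonal_complement (closed_cspan K) = orthogonal_complement (K :: 'h::complex_hilbert set)"
proof
  show "orthogonal_complement (closed_cspan K) \<subseteq> orthogonal_complement K"
    using subset_closed_cspan[of K] by (auto simp: orthogonal_complement_def)
  have "K \<subseteq> orthogonal_complement (orthogonal_complement K)"
    by (auto simp: orthogonal_complement_def intro: cinner_eq_0_sym)
  then have *: "closed_cspan K \<subseteq> orthogonal_complement (orthogonal_complement K)"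
    by (intro closed_cspan_minimal closed_orthogonal_complement subspace_orthogonal_complement)
  show "orthogonal_complement K \<subseteq> orthogonal_complement (closed_cspan K)"
  proof
    fix u assume "u \<in> orthogonal_complement K"
    then have "cinner v u = 0" if "v \<in> closed_cspan K" for v
      using * that unfolding orthogonal_complement_def[of "orthogonal_complement K"] by blast
    then show "u \<in> orthogonal_complement (closed_cspan K)"
      by (simp add: orthogonal_complement_def cinner_eq_0_sym)
  qed
qed

lemma frame_with_bounds_subset:
  "frame_with_bounds A B I f M \<Longrightarrow> f ` I \<subseteq> K \<Longrightarrow> K \<subseteq> M \<Longrightarrow> frame_with_bounds A B I f K"
  by (auto simp: frame_with_bounds_def)

lemma is_frame_subset: "is_frame I f M \<Longrightarrow> f ` I \<subseteq> K \<Longrightarrow> K \<subseteq> M \<Longrightarrow> is_frame I f K"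
  unfolding is_frame_def by (meson frame_with_bounds_subset)

lemma is_frame_imp_closed_subspace_frame:
  assumes "is_frame I f M" "closed M" "complex_vector.subspace M"
  shows "\<exists>A B. closed_subspace_frame A B I f M"
proof -
  obtain A B where AB: "A > 0" "frame_with_bounds A B I f M"
    using assms by (auto simp: is_frame_def)
  \<comment> \<open>Enlarging the upper bound is harmless and secures the ordering of the bounds
    that the locale demands.\<close>
  then have "frame_with_bounds A (max A B) I f M"
    using mult_right_mono[of B "max A B" "(norm _)\<^sup>2"]
    by (fastforce simp: frame_with_bounds_def intro: order_trans)
  then have "closed_subspace_frame A (max A B) I f M"
    using AB assms by unfold_locales auto
  then show ?thesis by blast
qed

section \<open>Unitary representations and invariance of the complement\<close>

locale group_unitary_representation = group G for G :: "('g, 'b) monoid_scheme" +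
  fixes \<pi> :: "'g \<Rightarrow> 'h::complex_hilbert \<Rightarrow> 'h"
  assumes rep: "unitary_representation G \<pi>"
begin

lemma unitary: "g \<in> carrier G \<Longrightarrow> unitary_op (\<pi> g)"
  using rep by (simp add: unitary_representation_def)

lemma cinner_rep: "g \<in> carrier G \<Longrightarrow> cinner (\<pi> g x) (\<pi> g y) = cinner x y"
  using unitary by (simp add: unitary_op_def)

lemma rep_mult: "g \<in> carrier G \<Longrightarrow> h \<in> carrier G \<Longrightarrow> \<pi> (g \<otimes>\<^bsub>G\<^esub> h) x = \<pi> g (\<pi> h x)"
  using rep by (simp add: unitary_representation_def)

text \<open>The operator of the unit is idempotent by multiplicativity and injective by unitarity,
  hence the identity.\<close>

lemma rep_one: "\<pi> \<one>\<^bsub>G\<^esub> x = x"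
  using rep_mult[of "\<one>\<^bsub>G\<^esub>" "\<one>\<^bsub>G\<^esub>" x] unitary[of "\<one>\<^bsub>G\<^esub>"]
  by (simp add: unitary_op_def bij_def inj_eq)

lemma cinner_rep_left:
  assumes "g \<in> carrier G"
  shows "cinner (\<pi> g x) y = cinner x (\<pi> (inv\<^bsub>G\<^esub> g) y)"
  using cinner_rep[OF assms, of x "\<pi> (inv\<^bsub>G\<^esub> g) y"] assms
  by (simp add: rep_mult[symmetric] rep_one)

lemma bounded_linear_rep:
  assumes g: "g \<in> carrier G"
  shows "bounded_linear (\<pi> g)"
proof (rule bounded_linear_intro[where K = 1])
  interpret L: Vector_Spaces.linear cscale cscale "\<pi> g"
    using unitary[OF g] by (simp add: unitary_op_def)
  show "\<pi> g (x + y) = \<pi> g x + \<pi> g y" "\<pi> g (r *\<^sub>R x) = r *\<^sub>R \<pi> g x" for x y r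
    by (simp_all add: L.add L.scale scaleR_eq_cscale)
  have "complex_of_real ((norm (\<pi> g x))\<^sup>2) = complex_of_real ((norm x)\<^sup>2)" for x
    using cinner_rep[OF g, of x x] by (simp only: cinner_self)
  then show "norm (\<pi> g x) \<le> norm x * 1" for x
    by (simp only: of_real_eq_iff) (simp add: power2_eq_iff_nonneg)
qed

lemma rep_cscale: "g \<in> carrier G \<Longrightarrow> \<pi> g (c *c x) = c *c \<pi> g x"
  using unitary[of g] by (auto simp: unitary_op_def Vector_Spaces.linear_iff)

abbreviation "complement Y \<equiv> orthogonal_complement (generated_subspace G \<pi> Y)"

lemma mem_complement_iff:
  "u \<in> complement Y \<longleftrightarrow> (\<forall>g\<in>carrier G. \<forall>y\<in>Y. cinner u (\<pi> g y) = 0)"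
  unfolding generated_subspace_def orthogonal_complement_closed_cspan
  by (auto simp: orthogonal_complement_def)

text \<open>Moving \<open>\<pi> h\<close> to the other side of the inner product only translates
  within the orbits of \<open>Y\<close>.\<close>

lemma rep_in_complement: "h \<in> carrier G \<Longrightarrow> u \<in> complement Y \<Longrightarrow> \<pi> h u \<in> complement Y"
  by (simp add: mem_complement_iff cinner_rep_left rep_mult[symmetric])

lemma orbit_in_generated: "orbit_family \<pi> ` orbit_index G Y \<subseteq> generated_subspace G \<pi> Y"
  unfolding generated_subspace_def by (rule subset_closed_cspan)

lemma rep_complement_orthogonal:
  assumes "h \<in> carrier G" "u \<in> complement Y" "v \<in> generated_subspace G \<pi> Y"
  shows "cinner u (\<pi> h v) = 0"
proof -
  have "cinner (\<pi> (inv\<^bsub>G\<^esub> h) u) v = 0"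
    using rep_in_complement[of "inv\<^bsub>G\<^esub> h" u] assms by (auto simp: orthogonal_complement_def)
  then show ?thesis using assms by (simp add: cinner_rep_left)
qed

section \<open>Frames for the orthogonal complement of a generated subspace\<close>

lemma ex_generated_projection:
  assumes "wandering_frame_collection G \<pi> Y"
  shows "\<exists>p\<in>generated_subspace G \<pi> Y. u - p \<in> complement Y"
proof -
  obtain A B where
    "closed_subspace_frame A B (orbit_index G Y) (orbit_family \<pi>) (generated_subspace G \<pi> Y)"
    using is_frame_imp_closed_subspace_frame assms
    unfolding wandering_frame_collection_def generated_subspace_def
    by (metis closed_closed_cspan subspace_closed_cspan)
  then interpret F: closed_subspace_frame A B "orbit_index G Y" "orbit_family \<pi>"
    "generated_subspace G \<pi> Y" .
  show ?thesis using F.ex_projection by (auto simp: orthogonal_complement_def)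
qed

text \<open>Tested against a vector of the complement, the orbit of \<open>z\<close> and the orbit
  of its projection \<open>q z\<close> have the same coefficients, and the vectors of
  \<open>V - Z\<close> contribute nothing. The frame sum over \<open>V\<close> is therefore carried
  by the projections of \<open>Z\<close>.\<close>

lemma project_frame_to_complement:
  assumes Y: "wandering_frame_collection G \<pi> Y"
    and V: "finite V" "is_frame (orbit_index G V) (orbit_family \<pi>) UNIV"
    and Z: "Z \<subseteq> V" "V - Z \<subseteq> generated_subspace G \<pi> Y"
  shows "\<exists>X. finite X \<and> card X \<le> card Z \<and>
    is_frame (orbit_index G X) (orbit_family \<pi>) (complement Y)"
proof -
  have fin: "finite Z" using V Z finite_subset by blast
  define K where "K = generated_subspace G \<pi> Y"
  obtain p where p: "\<And>z. p z \<in> K" "\<And>z. z - p z \<in> complement Y"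
    using ex_generated_projection[OF Y] unfolding K_def by metis
  define q where "q z = z - p z" for z
  obtain A B where AB: "A > 0" "B > 0" "frame_with_bounds A B (orbit_index G V) (orbit_family \<pi>) UNIV"
    using V by (auto simp: is_frame_def)
  define e where "e v u = (\<Sum>\<^sub>\<infinity>g\<in>carrier G. (cmod (cinner u (\<pi> g v)))\<^sup>2)" for v u
  have e_nonneg: "0 \<le> e v u" for v u
    unfolding e_def by (rule infsum_nonneg) simp
  have has_e: "((\<lambda>g. (cmod (cinner u (\<pi> g v)))\<^sup>2) has_sum e v u) (carrier G)" if "v \<in> V" for u v
  proof -
    have "(\<lambda>i. (cmod (cinner u (orbit_family \<pi> i)))\<^sup>2) summable_on orbit_index G V"
      using AB(3) unfolding frame_with_bounds_def by blast
    then have "(\<lambda>i. (cmod (cinner u (orbit_family \<pi> i)))\<^sup>2) summable_on (\<lambda>g. (g, v)) ` carrier G"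
      by (rule summable_on_subset_banach) (use that in auto)
    also have "?this \<longleftrightarrow> (\<lambda>g. (cmod (cinner u (\<pi> g v)))\<^sup>2) summable_on carrier G"
      by (subst summable_on_reindex) (simp_all add: inj_on_def o_def)
    finally show ?thesis unfolding e_def by (rule has_sum_infsum)
  qed
  have sum_V: "((\<lambda>i. (cmod (cinner u (orbit_family \<pi> i)))\<^sup>2) has_sum (\<Sum>v\<in>V. e v u)) (orbit_index G V)" for u
    using has_sum_Times_finite[OF V(1), of "\<lambda>i. (cmod (cinner u (orbit_family \<pi> i)))\<^sup>2"] has_e by simp
  have q_eq: "cinner u (\<pi> g (q z)) = cinner u (\<pi> g z)" if "u \<in> complement Y" "g \<in> carrier G" for u g z
  proof -
    interpret L: bounded_linear "\<pi> g" by (rule bounded_linear_rep[OF that(2)])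
    show ?thesis
      using rep_complement_orthogonal[OF that(2,1) p(1)[unfolded K_def]]
      by (simp add: q_def L.diff cinner_diff_right)
  qed
  \<comment> \<open>Distinct vectors of \<open>Z\<close> may have the same projection, and the set
    \<open>q\<close> followed by \<open>Z\<close> as an image counts it once. This costs at most a
    factor \<open>card Z\<close> in the lower bound; adding 1 keeps the divisor positive when
    \<open>Z\<close> is empty.\<close>
  let ?C = "real (card Z) + 1"
  have "frame_with_bounds (A / ?C) B (orbit_index G (q ` Z)) (orbit_family \<pi>) (complement Y)"
    unfolding frame_with_bounds_def
  proof (intro conjI ballI)
    show "orbit_family \<pi> ` orbit_index G (q ` Z) \<subseteq> complement Y"
      using p(2) rep_in_complement by (auto simp: q_def)
    fix u assume u: "u \<in> complement Y"
    have e_q: "e (q z) u = e z u" for z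
      unfolding e_def using u by (intro infsum_cong) (simp add: q_eq)
    have sum_q: "((\<lambda>i. (cmod (cinner u (orbit_family \<pi> i)))\<^sup>2) has_sum (\<Sum>x\<in>q ` Z. e x u))
        (orbit_index G (q ` Z))"
    proof (rule has_sum_Times_finite)
      fix x assume "x \<in> q ` Z"
      then obtain z where z: "z \<in> Z" "x = q z" by blast
      have "((\<lambda>g. (cmod (cinner u (\<pi> g x)))\<^sup>2) has_sum e x u) (carrier G) \<longleftrightarrow>
          ((\<lambda>g. (cmod (cinner u (\<pi> g z)))\<^sup>2) has_sum e x u) (carrier G)"
        by (rule has_sum_cong) (simp add: z q_eq u)
      then show "((\<lambda>g. (cmod (cinner u (orbit_family \<pi> (g, x))))\<^sup>2) has_sum e x u) (carrier G)"
        using has_e[of z u] Z z e_q by auto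
    qed (use fin in simp)
    then show "(\<lambda>i. (cmod (cinner u (orbit_family \<pi> i)))\<^sup>2) summable_on orbit_index G (q ` Z)"
      by (rule has_sum_imp_summable)
    note infsum_q = infsumI[OF sum_q]
    have "e v u = 0" if "v \<in> V - Z" for v
      unfolding e_def
      by (rule infsum_0) (use rep_complement_orthogonal[OF _ u] that Z in auto)
    then have sum_VZ: "(\<Sum>v\<in>V. e v u) = (\<Sum>z\<in>Z. e z u)"
      using V Z by (intro sum.mono_neutral_right) auto
    have "A * (norm u)\<^sup>2 \<le> (\<Sum>\<^sub>\<infinity>i\<in>orbit_index G V. (cmod (cinner u (orbit_family \<pi> i)))\<^sup>2)"
      "(\<Sum>\<^sub>\<infinity>i\<in>orbit_index G V. (cmod (cinner u (orbit_family \<pi> i)))\<^sup>2) \<le> B * (norm u)\<^sup>2"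
      using AB(3) unfolding frame_with_bounds_def by blast+
    then have sum_Z: "A * (norm u)\<^sup>2 \<le> (\<Sum>z\<in>Z. e z u)" "(\<Sum>z\<in>Z. e z u) \<le> B * (norm u)\<^sup>2"
      unfolding infsumI[OF sum_V] sum_VZ .
    have "(\<Sum>x\<in>q ` Z. e x u) \<le> (\<Sum>z\<in>Z. e (q z) u)"
      using sum_image_le[OF fin, of "\<lambda>x. e x u" q] e_nonneg by (simp add: o_def)
    then show "(\<Sum>\<^sub>\<infinity>i\<in>orbit_index G (q ` Z). (cmod (cinner u (orbit_family \<pi> i)))\<^sup>2) \<le> B * (norm u)\<^sup>2"
      using sum_Z(2) unfolding infsum_q e_q by simp
    have "e z u \<le> (\<Sum>x\<in>q ` Z. e x u)" if "z \<in> Z" for z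
      using member_le_sum[of "q z" "q ` Z" "\<lambda>x. e x u"] that fin e_nonneg e_q by auto
    then have "(\<Sum>z\<in>Z. e z u) \<le> real (card Z) * (\<Sum>x\<in>q ` Z. e x u)"
      by (rule sum_bounded_above)
    also have "\<dots> \<le> ?C * (\<Sum>x\<in>q ` Z. e x u)"
      using e_nonneg by (intro mult_right_mono sum_nonneg) auto
    finally show "A / ?C * (norm u)\<^sup>2
        \<le> (\<Sum>\<^sub>\<infinity>i\<in>orbit_index G (q ` Z). (cmod (cinner u (orbit_family \<pi> i)))\<^sup>2)"
      unfolding infsum_q using sum_Z(1) by (simp add: field_simps)
  qed
  then have "is_frame (orbit_index G (q ` Z)) (orbit_family \<pi>) (complement Y)"
    unfolding is_frame_def using AB by (intro exI[of _ "A / ?C"] exI[of _ B]) auto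
  then show ?thesis
    using fin card_image_le[OF fin, of q] by (intro exI[of _ "q ` Z"]) auto
qed

text \<open>The frame operator commutes with the representation, so its root \<open>V\<close> does
  too. Choosing preimages under \<open>V\<close> of the generators then applies the inverse root to
  the whole orbit family at once.\<close>

lemma normalize_frame:
  assumes X: "finite X" "is_frame (orbit_index G X) (orbit_family \<pi>) M"
    and M: "closed M" "complex_vector.subspace M"
    and inv: "\<And>g u. g \<in> carrier G \<Longrightarrow> u \<in> M \<Longrightarrow> \<pi> g u \<in> M"
  shows "\<exists>X'. finite X' \<and> card X' = card X \<and>
    normalized_tight_frame (orbit_index G X') (orbit_family \<pi>) M"
proof -
  obtain A B where "closed_subspace_frame A B (orbit_index G X) (orbit_family \<pi>) M"
    using is_frame_imp_closed_subspace_frame X M by blast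
  then interpret F: closed_subspace_frame A B "orbit_index G X" "orbit_family \<pi>" M .
  have S_rep: "F.S (\<pi> h u) = \<pi> h (F.S u)" if h: "h \<in> carrier G" for h u
  proof (rule F.S_eqI)
    \<comment> \<open>Translation by \<open>h\<close> permutes the orbit index, so reindexing the
      series of \<open>F.S\<close> gives the commutation.\<close>
    let ?b = "\<lambda>(g, x). (h \<otimes>\<^bsub>G\<^esub> g, x)"
    have b: "bij_betw ?b (orbit_index G X) (orbit_index G X)"
      by (rule bij_betwI[where g = "\<lambda>(g, x). (inv\<^bsub>G\<^esub> h \<otimes>\<^bsub>G\<^esub> g, x)"])
        (use h in \<open>auto simp: m_assoc[symmetric]\<close>)
    have "((\<lambda>i. \<pi> h (cinner u (orbit_family \<pi> i) *c orbit_family \<pi> i)) has_sum \<pi> h (F.S u))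
        (orbit_index G X)"
      using bounded_linear_rep[OF h] F.has_sum_S by (rule has_sum_bounded_linear)
    also have "?this \<longleftrightarrow> ((\<lambda>i. cinner (\<pi> h u) (orbit_family \<pi> (?b i)) *c orbit_family \<pi> (?b i))
        has_sum \<pi> h (F.S u)) (orbit_index G X)"
      using h by (intro has_sum_cong) (auto simp: rep_mult cinner_rep rep_cscale)
    also have "\<dots> \<longleftrightarrow> ((\<lambda>i. cinner (\<pi> h u) (orbit_family \<pi> i) *c orbit_family \<pi> i)
        has_sum \<pi> h (F.S u)) (orbit_index G X)"
      by (rule has_sum_reindex_bij_betw[OF b])
    finally show "((\<lambda>i. cinner (\<pi> h u) (orbit_family \<pi> i) *c orbit_family \<pi> i)
        has_sum \<pi> h (F.S u)) (orbit_index G X)" .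
  qed
  have "\<forall>U\<in>\<pi> ` carrier G. bounded_linear U \<and> U ` M \<subseteq> M \<and> (\<forall>u\<in>M. F.S (U u) = U (F.S u))"
    using bounded_linear_rep inv S_rep by auto
  from F.ex_sqrt_S[OF this] obtain V where V: "bounded_linear V" "V ` M = M"
    "\<And>u v. u \<in> M \<Longrightarrow> v \<in> M \<Longrightarrow> cinner (V u) v = cinner u (V v)"
    "\<And>g u. g \<in> carrier G \<Longrightarrow> u \<in> M \<Longrightarrow> V (\<pi> g u) = \<pi> g (V u)"
    "\<And>u. u \<in> M \<Longrightarrow> V (V u) = F.S u"
    by blast
  have "X \<subseteq> M"
    using F.f_in[of "(\<one>\<^bsub>G\<^esub>, _)"] by (auto simp: rep_one)
  then have "\<forall>x\<in>X. \<exists>z\<in>M. V z = x"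
    using V(2) by (metis imageE subsetD)
  then obtain \<phi> where \<phi>: "\<And>x. x \<in> X \<Longrightarrow> \<phi> x \<in> M" "\<And>x. x \<in> X \<Longrightarrow> V (\<phi> x) = x"
    by metis
  \<comment> \<open>\<open>V\<close> is a left inverse of \<open>\<phi>\<close> on \<open>X\<close>,
    so no generators merge and the cardinality is preserved.\<close>
  have inj: "inj_on \<phi> X"
    by (metis \<phi>(2) inj_onI)
  let ?b = "\<lambda>(g, x). (g, \<phi> x)"
  have b: "bij_betw ?b (orbit_index G X) (orbit_index G (\<phi> ` X))"
    using inj by (auto simp: bij_betw_def inj_on_def)
  have "normalized_tight_frame (orbit_index G X) (\<lambda>i. orbit_family \<pi> (?b i)) M"
    by (rule F.normalized_tight_frame_sqrt[OF V(2,3,5)]) (auto simp: \<phi> V(4) inv)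
  moreover have "(\<lambda>i. (cmod (cinner u (orbit_family \<pi> (?b i))))\<^sup>2) summable_on orbit_index G X \<longleftrightarrow>
      (\<lambda>i. (cmod (cinner u (orbit_family \<pi> i)))\<^sup>2) summable_on orbit_index G (\<phi> ` X)"
    "(\<Sum>\<^sub>\<infinity>i\<in>orbit_index G X. (cmod (cinner u (orbit_family \<pi> (?b i))))\<^sup>2) =
      (\<Sum>\<^sub>\<infinity>i\<in>orbit_index G (\<phi> ` X). (cmod (cinner u (orbit_family \<pi> i)))\<^sup>2)" for u
    using summable_on_reindex_bij_betw[OF b, of "\<lambda>i. (cmod (cinner u (orbit_family \<pi> i)))\<^sup>2"]
      infsum_reindex_bij_betw[OF b, of "\<lambda>i. (cmod (cinner u (orbit_family \<pi> i)))\<^sup>2"]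
    by auto
  moreover have "orbit_family \<pi> ` orbit_index G (\<phi> ` X) = (\<lambda>i. orbit_family \<pi> (?b i)) ` orbit_index G X"
    by (force simp: image_iff)
  ultimately have "normalized_tight_frame (orbit_index G (\<phi> ` X)) (orbit_family \<pi>) M"
    unfolding normalized_tight_frame_def frame_with_bounds_def by simp
  then show ?thesis
    using X card_image[OF inj] by (intro exI[of _ "\<phi> ` X"]) auto
qed

text \<open>Split \<open>u\<close> orthogonally into \<open>p\<close> in the subspace generated by
  \<open>Y\<close> and \<open>q\<close> in its complement. The orbits of \<open>X\<close> see only
  \<open>q\<close>, those of \<open>Y\<close> only \<open>p\<close>, and the two frame estimates add
  up.\<close>

lemma tight_frame_complement:
  assumes Y: "wandering_frame_collection G \<pi> Y"
    and X: "finite X" "normalized_tight_frame (orbit_index G X) (orbit_family \<pi>) (complement Y)"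
  shows "complementary G \<pi> X Y"
    and "normalized_tight_frame (orbit_index G X) (orbit_family \<pi>) (generated_subspace G \<pi> X)"
proof -
  define K where "K = generated_subspace G \<pi> Y"
  have orbit_X: "\<pi> g x \<in> complement Y" if "g \<in> carrier G" "x \<in> X" for g x
    using X(2) that by (auto simp: normalized_tight_frame_def frame_with_bounds_def)
  have orbit_Y: "\<pi> g y \<in> K" if "g \<in> carrier G" "y \<in> Y" for g y
    using orbit_in_generated[of Y] that by (auto simp: K_def)
  have "generated_subspace G \<pi> X \<subseteq> complement Y"
    unfolding generated_subspace_def[of G \<pi> X] using orbit_X
    by (intro closed_cspan_minimal closed_orthogonal_complement subspace_orthogonal_complement) auto
  then show tight: "normalized_tight_frame (orbit_index G X) (orbit_family \<pi>) (generated_subspace G \<pi> X)"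
    using X(2) orbit_in_generated[of X]
    unfolding normalized_tight_frame_def by (blast intro: frame_with_bounds_subset)
  then have wX: "wandering_frame_collection G \<pi> X"
    using X(1) unfolding wandering_frame_collection_def is_frame_def normalized_tight_frame_def
    by (auto intro!: exI[of _ "1::real"])
  obtain A B where AB: "A > 0" "B > 0" "frame_with_bounds A B (orbit_index G Y) (orbit_family \<pi>) K"
    using Y by (auto simp: wandering_frame_collection_def is_frame_def K_def)
  \<comment> \<open>The bounds combine the value 1 on the complement with \<open>A\<close> and
    \<open>B\<close> on the subspace generated by \<open>Y\<close>.\<close>
  have "frame_with_bounds (min 1 A) (max 1 B) (orbit_index G (X \<union> Y)) (orbit_family \<pi>) UNIV"
    unfolding frame_with_bounds_def
  proof (intro conjI ballI)
    fix u :: 'h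
    obtain p where p: "p \<in> K" "u - p \<in> complement Y"
      using ex_generated_projection[OF Y] unfolding K_def by blast
    define q where "q = u - p"
    have q: "q \<in> complement Y" "u = p + q" using p by (auto simp: q_def)
    have orth: "cinner a b = 0" "cinner b a = 0" if "a \<in> K" "b \<in> complement Y" for a b
    proof -
      show "cinner b a = 0"
        using that by (auto simp: orthogonal_complement_def K_def)
      then show "cinner a b = 0" by (rule cinner_eq_0_sym)
    qed
    have norm_u: "(norm u)\<^sup>2 = (norm p)\<^sup>2 + (norm q)\<^sup>2"
    proof -
      have "complex_of_real ((norm u)\<^sup>2) = complex_of_real ((norm p)\<^sup>2 + (norm q)\<^sup>2)"
        using orth[OF p(1) q(1)] unfolding of_real_add cinner_self[symmetric] q(2)
        by (simp add: cinner_add_left cinner_add_right)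
      then show ?thesis by (simp only: of_real_eq_iff)
    qed
    let ?s = "\<lambda>u i. (cmod (cinner u (orbit_family \<pi> i)))\<^sup>2"
    have "(?s q has_sum (norm q)\<^sup>2) (orbit_index G X)"
      using X(2) q(1) by (auto simp: normalized_tight_frame_def frame_with_bounds_def has_sum_iff)
    also have "?this \<longleftrightarrow> (?s u has_sum (norm q)\<^sup>2) (orbit_index G X)"
      by (rule has_sum_cong) (auto simp: q(2) cinner_add_left orth p orbit_X)
    finally have sum_X: \<dots> .
    obtain b where b: "(?s p has_sum b) (orbit_index G Y)" "A * (norm p)\<^sup>2 \<le> b" "b \<le> B * (norm p)\<^sup>2"
      using AB(3) p(1) by (auto simp: frame_with_bounds_def has_sum_iff)
    \<comment> \<open>The union counts a common element of \<open>X\<close> and \<open>Y\<close>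
      once. Its orbit lies in the complement, hence is orthogonal to \<open>p\<close>, so it can be
      left to \<open>X\<close>.\<close>
    have "(?s p has_sum b) (orbit_index G Y) \<longleftrightarrow> (?s u has_sum b) (orbit_index G (Y - X))"
    proof (rule has_sum_cong_neutral)
      fix i assume "i \<in> orbit_index G Y - orbit_index G (Y - X)"
      then show "?s p i = 0"
        by (auto simp: orth p orbit_X)
    next
      fix i assume "i \<in> orbit_index G Y \<inter> orbit_index G (Y - X)"
      then show "?s p i = ?s u i"
        by (auto simp: q(2) cinner_add_left orth orbit_Y q(1))
    qed auto
    then have "(?s u has_sum ((norm q)\<^sup>2 + b)) (orbit_index G X \<union> orbit_index G (Y - X))"
      using sum_X b by (intro has_sum_Un_disjoint) auto
    also have "orbit_index G X \<union> orbit_index G (Y - X) = orbit_index G (X \<union> Y)" by auto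
    finally have sum: "(?s u has_sum ((norm q)\<^sup>2 + b)) (orbit_index G (X \<union> Y))" .
    then show "?s u summable_on orbit_index G (X \<union> Y)" by (rule has_sum_imp_summable)
    have "min 1 A * (norm q)\<^sup>2 \<le> 1 * (norm q)\<^sup>2" "min 1 A * (norm p)\<^sup>2 \<le> A * (norm p)\<^sup>2"
      "1 * (norm q)\<^sup>2 \<le> max 1 B * (norm q)\<^sup>2" "B * (norm p)\<^sup>2 \<le> max 1 B * (norm p)\<^sup>2"
      by (intro mult_right_mono; simp)+
    then show "min 1 A * (norm u)\<^sup>2 \<le> (\<Sum>\<^sub>\<infinity>i\<in>orbit_index G (X \<union> Y). ?s u i)"
      "(\<Sum>\<^sub>\<infinity>i\<in>orbit_index G (X \<union> Y). ?s u i) \<le> max 1 B * (norm u)\<^sup>2"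
      using b unfolding infsumI[OF sum] norm_u distrib_left by linarith+
  qed auto
  then have "is_frame (orbit_index G (X \<union> Y)) (orbit_family \<pi>) UNIV"
    unfolding is_frame_def using AB by (intro exI[of _ "min 1 A"] exI[of _ "max 1 B"] conjI) auto
  moreover from this have
    "is_frame (orbit_index G (X \<union> Y)) (orbit_family \<pi>) (generated_subspace G \<pi> (X \<union> Y))"
    using orbit_in_generated[of "X \<union> Y"] by (rule is_frame_subset) simp
  ultimately show "complementary G \<pi> X Y"
    using wX Y X(1)
    by (auto simp: complementary_def complete_wandering_frame_collection_def wandering_frame_collection_def)
qed

end

text \<open>The independence of \<open>k\<close> is expressed by a function \<open>\<kappa>\<close>
  that is fixed before \<open>W\<close> and \<open>Y\<close> and sees only the subspace generated by
  \<open>Y\<close>.\<close>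

theorem theorem3:
  fixes G :: "('g, 'b) monoid_scheme"
    and \<pi> :: "'g \<Rightarrow> 'h::complex_hilbert \<Rightarrow> 'h"
  assumes "comm_group G"
    and "countable (carrier G)"
    and "unitary_representation G \<pi>"
  shows "\<exists>\<kappa> :: 'h set \<Rightarrow> nat. \<forall>W Y.
           complete_wandering_frame_collection G \<pi> W \<longrightarrow>
           wandering_frame_collection G \<pi> Y \<longrightarrow>
           (\<exists>k. k = \<kappa> (generated_subspace G \<pi> Y) \<and>
              (\<exists>X. complementary G \<pi> X Y \<and> card X = k \<and>
                 normalized_tight_frame (orbit_index G X) (orbit_family \<pi>)
                   (generated_subspace G \<pi> X)) \<and>
              (\<forall>Z. complementary G \<pi> Z Y \<longrightarrow> k \<le> card Z))"
proof -
  interpret comm_group G by fact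
  interpret group_unitary_representation G \<pi>
    by unfold_locales (rule assms(3))
  define Q where "Q K n \<longleftrightarrow> (\<exists>X. finite X \<and> card X = n \<and>
    is_frame (orbit_index G X) (orbit_family \<pi>) (orthogonal_complement K))" for K n
  define \<kappa> where "\<kappa> K = (LEAST n. Q K n)" for K
  have "(\<exists>X. complementary G \<pi> X Y \<and> card X = \<kappa> (generated_subspace G \<pi> Y) \<and>
        normalized_tight_frame (orbit_index G X) (orbit_family \<pi>) (generated_subspace G \<pi> X)) \<and>
      (\<forall>Z. complementary G \<pi> Z Y \<longrightarrow> \<kappa> (generated_subspace G \<pi> Y) \<le> card Z)"
    if W: "complete_wandering_frame_collection G \<pi> W" and Y: "wandering_frame_collection G \<pi> Y"
    for W Y
  proof (intro conjI allI impI)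
    let ?K = "generated_subspace G \<pi> Y"
    \<comment> \<open>Projecting all of \<open>W\<close> shows that some cardinality is attained, so
      the least one is meaningful.\<close>
    obtain n where "Q ?K n"
      using project_frame_to_complement[OF Y, of W W] W
      unfolding Q_def complete_wandering_frame_collection_def wandering_frame_collection_def by auto
    then have "Q ?K (\<kappa> ?K)" unfolding \<kappa>_def by (rule LeastI)
    then obtain X0 where X0: "finite X0" "card X0 = \<kappa> ?K"
      "is_frame (orbit_index G X0) (orbit_family \<pi>) (complement Y)"
      unfolding Q_def by blast
    obtain X where X: "finite X" "card X = \<kappa> ?K"
      "normalized_tight_frame (orbit_index G X) (orbit_family \<pi>) (complement Y)"
      using normalize_frame[OF X0(1,3) closed_orthogonal_complement subspace_orthogonal_complement
          rep_in_complement] X0(2) by auto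
    show "\<exists>X. complementary G \<pi> X Y \<and> card X = \<kappa> ?K \<and>
        normalized_tight_frame (orbit_index G X) (orbit_family \<pi>) (generated_subspace G \<pi> X)"
      using tight_frame_complement[OF Y X(1,3)] X(2) by blast
    fix Z assume Z: "complementary G \<pi> Z Y"
    \<comment> \<open>The unit of the group puts \<open>Y\<close> into its own orbits. Hence the
      part of \<open>Z \<union> Y\<close> outside \<open>Z\<close> lies in \<open>?K\<close>, as the
      projection lemma requires.\<close>
    have "Y \<subseteq> ?K"
      using orbit_in_generated[of Y] by (force simp: rep_one)
    then obtain X' where X': "finite X'" "card X' \<le> card Z"
      "is_frame (orbit_index G X') (orbit_family \<pi>) (complement Y)"
      using project_frame_to_complement[OF Y, of "Z \<union> Y" Z] Z
      unfolding complementary_def complete_wandering_frame_collection_def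
        wandering_frame_collection_def by auto
    then have "\<kappa> ?K \<le> card X'"
      unfolding \<kappa>_def Q_def by (intro Least_le) blast
    then show "\<kappa> ?K \<le> card Z" using X' by simp
  qed
  then show ?thesis
    by (intro exI[of _ \<kappa>]) simp
qed

end
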